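(* Let $m\ge 2$. The arithmetical structures $(d,r)$ on $P_2\square P_m$ such that $r(1,i)=r(2,i)$ for all $i=1,\dots,m$ are in bijection with the arithmetical structures on $P_m$. In particular, the number of such symmetric structures is the Catalan number $C_{m-1}$.
   Context: An arithmetical structure on a finite connected graph $G$ is a pair $(d,r)$ of vectors of positive integers indexed by the vertices of $G$ such that $r$ is primitive (the gcd of its entries is $1$) and $(\operatorname{diag}(d)-A(G))r=0$, where $A(G)$ is the adjacency matrix of $G$. $P_n$ is the path graph with vertex set $\{1,\dots,n\}$ and edges $\{i,i+1\}$, $1\le i<n$. The Cartesian product $G_1\square G_2$ has vertex set $V(G_1)\times V(G_2)$, with $(u_1,v_1)$ adjacent to $(u_2,v_2)$ iff ($u_1=u_2$ and $v_1v_2\in E(G_2)$) or ($v_1=v_2$ and $u_1u_2\in E(G_1)$). The Catalan numbers are $C_n=\frac{1}{n+1}\binom{2n}{n}$. *)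

theory Defs
  imports "Graph_Theory.Graph_Theory" "HOL-Library.FuncSet"
begin

text \<open>
  A finite simple graph is a \<open>pair_graph\<close>: a finite, loop-free digraph without parallel
  arcs whose arc relation is symmetric. An undirected edge \<open>{u, v}\<close> is thus the pair of arcs
  \<open>(u, v)\<close> and \<open>(v, u)\<close>.
\<close>

definition path_graph :: "nat \<Rightarrow> nat pair_pre_digraph" where
  "path_graph n = \<lparr> pverts = {1..n},
     parcs = {(i, j). i \<in> {1..n} \<and> j \<in> {1..n} \<and> (j = i + 1 \<or> i = j + 1)} \<rparr>"

definition cartesian_product ::
    "'a pair_pre_digraph \<Rightarrow> 'b pair_pre_digraph \<Rightarrow> ('a \<times> 'b) pair_pre_digraph"
    (infixr \<open>\<box>\<close> 80) where
  "G \<box> H = \<lparr> pverts = pverts G \<times> pverts H,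
     parcs = {((u1, v1), (u2, v2)).
       (u1 = u2 \<and> u1 \<in> pverts G \<and> (v1, v2) \<in> parcs H) \<or>
       (v1 = v2 \<and> v1 \<in> pverts H \<and> (u1, u2) \<in> parcs G)} \<rparr>"

definition adjacency_matrix :: "'a pair_pre_digraph \<Rightarrow> 'a \<Rightarrow> 'a \<Rightarrow> int" where
  "adjacency_matrix G u v = (if (u, v) \<in> parcs G then 1 else 0)"

definition diag_matrix :: "('a \<Rightarrow> int) \<Rightarrow> 'a \<Rightarrow> 'a \<Rightarrow> int" where
  "diag_matrix d u v = (if u = v then d u else 0)"

text \<open>
  Vectors indexed by the vertices are extensional functions: their value outside the vertex set
  is fixed, so that equal vectors are equal as functions and structures are counted correctly.
  The notion is meant for finite connected graphs; \<open>pair_graph_path_graph\<close>,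
  \<open>connected_path_graph\<close>, \<open>pair_graph_cartesian_product\<close> and \<open>connected_cartesian_product\<close>
  below show that the graphs considered here are of this kind.
\<close>

definition arithmetical_structures :: "'a pair_pre_digraph \<Rightarrow> (('a \<Rightarrow> int) \<times> ('a \<Rightarrow> int)) set" where
  "arithmetical_structures G =
     {(d, r). d \<in> pverts G \<rightarrow>\<^sub>E {0<..} \<and> r \<in> pverts G \<rightarrow>\<^sub>E {0<..} \<and>
        Gcd (r ` pverts G) = 1 \<and>
        (\<forall>u \<in> pverts G. (\<Sum>v \<in> pverts G. (diag_matrix d u v - adjacency_matrix G u v) * r v) = 0)}"

definition symmetric_structures :: "nat \<Rightarrow> ((nat \<times> nat \<Rightarrow> int) \<times> (nat \<times> nat \<Rightarrow> int)) set" where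
  "symmetric_structures m =
     {(d, r) \<in> arithmetical_structures (path_graph 2 \<box> path_graph m).
        \<forall>i \<in> {1..m}. r (1, i) = r (2, i)}"

text \<open>The division is exact, see \<open>Suc_times_catalan\<close>.\<close>

definition catalan :: "nat \<Rightarrow> nat" where
  "catalan n = ((2 * n) choose n) div (n + 1)"

lemma Suc_times_catalan: "(n + 1) * catalan n = (2 * n) choose n"
proof -
  have "(n + 1) * ((2 * n) choose (n + 1)) = n * ((2 * n) choose n)"
  proof -
    have "2 * n - n = n"
      by simp
    then show ?thesis
      using binomial_absorb_comp[of "2 * n" n] binomial_absorption[of n "2 * n"]
      by (metis Suc_eq_plus1)
  qed
  then have "(n + 1) dvd n * ((2 * n) choose n)"
    by (metis dvd_triv_left)
  moreover have "coprime (n + 1) n"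
    by simp
  ultimately have "(n + 1) dvd ((2 * n) choose n)"
    by (simp add: coprime_dvd_mult_right_iff)
  then show ?thesis
    unfolding catalan_def by (rule dvd_mult_div_cancel)
qed

lemma pair_graph_path_graph: "pair_graph (path_graph n)"
proof
  show "finite (parcs (path_graph n))"
    by (rule finite_subset[of _ "{1..n} \<times> {1..n}"]) (auto simp: path_graph_def)
qed (auto simp: path_graph_def symmetric_def sym_def)

lemma pair_graph_cartesian_product:
  assumes "pair_graph G" and "pair_graph H"
  shows "pair_graph (G \<box> H)"
proof -
  interpret G: pair_graph G by fact
  interpret H: pair_graph H by fact
  have sym: "sym (parcs G)" "sym (parcs H)"
    using G.pair_sym_arcs H.pair_sym_arcs by (auto simp: symmetric_def)
  have sub: "parcs (G \<box> H) \<subseteq> (pverts G \<times> pverts H) \<times> (pverts G \<times> pverts H)"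
    by (auto simp: cartesian_product_def dest: G.wellformed' H.wellformed')
  show ?thesis
  proof
    show "finite (parcs (G \<box> H))"
      using sub G.pair_finite_verts H.pair_finite_verts
      by (meson finite_SigmaI finite_subset)
    show "finite (pverts (G \<box> H))"
      using G.pair_finite_verts H.pair_finite_verts by (simp add: cartesian_product_def)
    show "symmetric (with_proj (G \<box> H))"
      using sym by (auto simp: symmetric_def cartesian_product_def sym_def)
  qed (use sub in \<open>auto simp: cartesian_product_def dest: G.pair_no_loops H.pair_no_loops
         G.wellformed' H.wellformed'\<close>)
qed

lemma connected_pair_graph_iff:
  assumes "pair_graph G"
  shows "connected (with_proj G) \<longleftrightarrow>
    pverts G \<noteq> {} \<and> (\<forall>u \<in> pverts G. \<forall>v \<in> pverts G. (u, v) \<in> (parcs G)\<^sup>*)"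
proof -
  interpret G: pair_graph G by fact
  have "sym (parcs G)"
    using G.pair_sym_arcs by (auto simp: symmetric_def)
  then have s: "symcl (parcs G) = parcs G"
    by (auto simp: symcl_def sym_def)
  have "(u, v) \<in> rtrancl_on (pverts G) (parcs G) \<longleftrightarrow> (u, v) \<in> (parcs G)\<^sup>*"
    if "u \<in> pverts G" for u v
  proof
    assume "(u, v) \<in> rtrancl_on (pverts G) (parcs G)"
    then show "(u, v) \<in> (parcs G)\<^sup>*"
      by (rule rtrancl_on_rtranclI)
  next
    assume "(u, v) \<in> (parcs G)\<^sup>*"
    then show "(u, v) \<in> rtrancl_on (pverts G) (parcs G)"
      by (induction rule: rtrancl_induct)
        (use that in \<open>auto dest: G.wellformed' intro: rtrancl_on_into_rtrancl_on\<close>)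
  qed
  then show ?thesis
    by (auto simp: connected_conv s)
qed

lemma connected_path_graph:
  assumes "1 \<le> n"
  shows "connected (with_proj (path_graph n))"
proof -
  let ?E = "parcs (path_graph n)"
  have up: "(1, i) \<in> ?E\<^sup>*" if "1 \<le> i" "i \<le> n" for i
    using that
  proof (induction i rule: dec_induct)
    case (step i)
    then have "(1, i) \<in> ?E\<^sup>*" "(i, Suc i) \<in> ?E"
      by (auto simp: path_graph_def)
    then show ?case
      by (rule rtrancl_into_rtrancl)
  qed simp
  have "sym ?E"
    by (auto simp: path_graph_def sym_def)
  then have "sym (?E\<^sup>*)"
    by (rule sym_rtrancl)
  then have "(u, v) \<in> ?E\<^sup>*" if "u \<in> {1..n}" "v \<in> {1..n}" for u v
    using up that by (meson atLeastAtMost_iff rtrancl_trans symD)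
  then show ?thesis
    using assms unfolding connected_pair_graph_iff[OF pair_graph_path_graph]
    by (auto simp: path_graph_def)
qed

lemma connected_cartesian_product:
  assumes "pair_graph G" "pair_graph H"
    and "connected (with_proj G)" "connected (with_proj H)"
  shows "connected (with_proj (G \<box> H))"
proof -
  have l: "((u, v), (u', v)) \<in> (parcs (G \<box> H))\<^sup>*"
    if "(u, u') \<in> (parcs G)\<^sup>*" "v \<in> pverts H" for u u' v
    using that(1)
  proof (induction rule: rtrancl_induct)
    case (step x y)
    then have "((x, v), (y, v)) \<in> parcs (G \<box> H)"
      using that(2) by (simp add: cartesian_product_def)
    with step.IH show ?case
      by (rule rtrancl_into_rtrancl)
  qed simp
  have r: "((u, v), (u, v')) \<in> (parcs (G \<box> H))\<^sup>*"
    if "(v, v') \<in> (parcs H)\<^sup>*" "u \<in> pverts G" for u v v'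
    using that(1)
  proof (induction rule: rtrancl_induct)
    case (step x y)
    then have "((u, x), (u, y)) \<in> parcs (G \<box> H)"
      using that(2) by (simp add: cartesian_product_def)
    with step.IH show ?case
      by (rule rtrancl_into_rtrancl)
  qed simp
  have pv: "pverts (G \<box> H) = pverts G \<times> pverts H"
    by (simp add: cartesian_product_def)
  have "((u, v), (u', v')) \<in> (parcs (G \<box> H))\<^sup>*"
    if "u \<in> pverts G" "u' \<in> pverts G" "v \<in> pverts H" "v' \<in> pverts H" for u u' v v'
    using assms that l[of u u' v] r[of v v' u']
    by (auto simp: connected_pair_graph_iff intro: rtrancl_trans)
  then show ?thesis
    using assms
    by (auto simp: connected_pair_graph_iff pair_graph_cartesian_product pv)
qed

end

theory Submission
  imports Defs "HOL-Library.Tree"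
begin

text \<open>
  On the ladder \<open>P\<^sub>2 \<box> P\<^sub>m\<close> a vertex has the neighbours of its column index in the path, taken in
  its own row, and one further neighbour, its twin in the other row. If \<open>r\<close> takes the same value on
  twins, the equation at \<open>(j, i)\<close> is the equation of the path at \<open>i\<close> with \<open>d (j, i) - 1\<close> in place of
  \<open>d\<close>. So adding \<open>1\<close> to \<open>d\<close> and copying both vectors to the two rows turns structures on \<open>P\<^sub>m\<close> into symmetric ones
  (\<open>bij_betw_duplicate_structure\<close>). In the other direction \<open>d (j, i) - 1\<close> stays positive because a
  vertex of \<open>P\<^sub>m\<close> has a neighbour when \<open>m \<ge> 2\<close>.

  Structures on the path are counted by a bijection with binary trees. Since \<open>r\<close> determines \<open>d\<close>, a
  structure amounts to a sequence \<open>r\<^sub>1, \<dots>, r\<^sub>m\<close> of positive integers, bordered by \<open>r\<^sub>0 = r\<^sub>m\<^sub>+\<^sub>1 = 0\<close>, in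
  which each \<open>r\<^sub>i\<close> divides \<open>r\<^sub>i\<^sub>-\<^sub>1 + r\<^sub>i\<^sub>+\<^sub>1\<close>. By these divisibilities \<open>r\<^sub>1\<close> divides every entry, so
  primitivity says \<open>r\<^sub>1 = 1\<close>. The entries \<open>r\<^sub>2, \<dots>, r\<^sub>m\<close> then fill the gap between \<open>1\<close> and \<open>0\<close> in
  \<open>1, r\<^sub>2, \<dots>, r\<^sub>m, 0\<close>. Inserting the mediant \<open>a + c\<close> between neighbours \<open>a, c\<close> preserves and reflects
  the divisibility property (\<open>divides_neighbours_insert_sum\<close>). Conversely, the last maximal entry of
  the gap equals the sum of its two neighbours and can be removed. Hence the admissible fillings
  are those obtained from the pair \<open>1, 0\<close> by repeated insertion of mediants (\<open>ex_mediants\<close>). As in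
  the Stern-Brocot construction, a binary tree records which gaps were filled, with one node for
  each inserted entry, and the tree can be recovered from the sequence (\<open>mediants_inject\<close>). So there
  are as many structures as binary trees with \<open>m - 1\<close> nodes, which the Catalan number \<open>C\<^sub>m\<^sub>-\<^sub>1\<close>
  counts (\<open>finite_card_trees\<close>).
\<close>

section \<open>Catalan numbers count binary trees\<close>

lemma catalan_Suc: "(n + 2) * catalan (Suc n) = (4 * n + 2) * catalan n"
proof -
  have "(n + 1) * ((2 * Suc n) choose Suc n) = 2 * (2 * n + 1) * ((2 * n) choose n)"
  proof -
    have "Suc n * (Suc (Suc (2 * n)) choose Suc n) = Suc (Suc (2 * n)) * (Suc (2 * n) choose n)"
      using Suc_times_binomial_eq[of "Suc (2 * n)" n] by (simp only: mult.commute)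
    moreover have "Suc n * (Suc (2 * n) choose n) = Suc (2 * n) * ((2 * n) choose n)"
      using binomial_absorb_comp[of "Suc (2 * n)" n] by (simp add: Suc_diff_le)
    ultimately have "Suc n * (Suc n * (Suc (Suc (2 * n)) choose Suc n)) =
        Suc n * (2 * (2 * n + 1) * ((2 * n) choose n))"
      by (simp add: algebra_simps)
    then have "Suc n * (Suc (Suc (2 * n)) choose Suc n) = 2 * (2 * n + 1) * ((2 * n) choose n)"
      by (simp only: Suc_mult_cancel1)
    moreover have "2 * Suc n = Suc (Suc (2 * n))"
      by simp
    ultimately show ?thesis
      by (simp only: Suc_eq_plus1)
  qed
  then have "(n + 1) * ((Suc n + 1) * catalan (Suc n)) = 2 * (2 * n + 1) * ((n + 1) * catalan n)"
    by (simp only: Suc_times_catalan)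
  then have "Suc n * ((n + 2) * catalan (Suc n)) = Suc n * ((4 * n + 2) * catalan n)"
    by (simp add: algebra_simps)
  then show ?thesis
    by (simp only: Suc_mult_cancel1)
qed

text \<open>
  Segner's recurrence, here derived from the closed form. By the symmetry \<open>i \<mapsto> n - i\<close>, weighting
  the terms of the convolution \<open>S n\<close> by \<open>i\<close> multiplies it by \<open>n / 2\<close>; weighting \<open>S (Suc n)\<close> by
  \<open>i + 1\<close> and applying the two-term recurrence \<open>catalan_Suc\<close> to each term leads back to \<open>S n\<close>.
\<close>
lemma catalan_convolution: "(\<Sum>i\<le>n. catalan i * catalan (n - i)) = catalan (Suc n)"
proof (induction n)
  case 0
  then show ?case
    by (simp add: catalan_def numeral_2_eq_2)
next
  case (Suc n)
  let ?S = "\<lambda>n. \<Sum>i\<le>n. catalan i * catalan (n - i)"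
  let ?T = "\<lambda>n. \<Sum>i\<le>n. i * (catalan i * catalan (n - i))"
  have T: "2 * ?T k = k * ?S k" for k
  proof -
    have "?T k = (\<Sum>i\<le>k. (k - i) * (catalan i * catalan (k - i)))"
      by (rule sum.reindex_bij_witness[where i = "\<lambda>i. k - i" and j = "\<lambda>i. k - i"]) auto
    then have "2 * ?T k = (\<Sum>i\<le>k. i * (catalan i * catalan (k - i))
        + (k - i) * (catalan i * catalan (k - i)))"
      by (simp add: sum.distrib)
    also have "\<dots> = (\<Sum>i\<le>k. k * (catalan i * catalan (k - i)))"
      by (intro sum.cong) (auto simp flip: distrib_right)
    finally show ?thesis
      by (simp add: sum_distrib_left)
  qed
  have "?T (Suc n) + ?S (Suc n) = (\<Sum>i\<le>Suc n. (i + 1) * catalan i * catalan (Suc n - i))"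
    by (simp add: sum.distrib algebra_simps del: sum.atMost_Suc)
  also have "\<dots> = catalan (Suc n) + (\<Sum>i\<le>n. (i + 2) * catalan (Suc i) * catalan (n - i))"
    unfolding sum.atMost_Suc_shift by (simp add: catalan_def[of "0 :: nat"])
  also have "\<dots> = catalan (Suc n) + (\<Sum>i\<le>n. (4 * i + 2) * catalan i * catalan (n - i))"
    by (simp only: catalan_Suc)
  also have "\<dots> = catalan (Suc n) + 4 * ?T n + 2 * ?S n"
    by (simp add: sum.distrib algebra_simps sum_distrib_left)
  finally have "(n + 3) * ?S (Suc n) = 2 * catalan (Suc n) + 4 * (2 * ?T n) + 4 * ?S n"
    using T[of "Suc n"] by (simp add: algebra_simps del: sum.atMost_Suc)
  then have "(n + 3) * ?S (Suc n) = (4 * Suc n + 2) * catalan (Suc n)"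
    unfolding T Suc.IH by (simp add: algebra_simps del: sum.atMost_Suc)
  also have "\<dots> = (n + 3) * catalan (Suc (Suc n))"
    using catalan_Suc[of "Suc n"] by (simp add: algebra_simps)
  finally show ?case
    by (simp del: sum.atMost_Suc)
qed

lemma finite_card_trees:
  "finite {t :: unit tree. size t = n} \<and> card {t :: unit tree. size t = n} = catalan n"
proof (induction n rule: less_induct)
  case (less n)
  let ?T = "\<lambda>n. {t :: unit tree. size t = n}"
  show ?case
  proof (cases n)
    case 0
    then have "?T n = {Leaf}"
      by auto
    with 0 show ?thesis
      by (simp add: catalan_def)
  next
    case (Suc k)
    let ?node = "\<lambda>(l, r). Node l () r"
    have split: "?T n = (\<Union>i\<le>k. ?node ` (?T i \<times> ?T (k - i)))"
    proof (intro set_eqI iffI)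
      fix t :: "unit tree"
      assume "t \<in> ?T n"
      then obtain l r where "t = Node l () r" "size l + size r = k"
        using Suc by (cases t) auto
      then show "t \<in> (\<Union>i\<le>k. ?node ` (?T i \<times> ?T (k - i)))"
        by (intro UN_I[of "size l"]) auto
    qed (use Suc in auto)
    have fin: "finite (?T i)" and card: "card (?T i) = catalan i" if "i \<le> k" for i
      using less.IH[of i] that Suc by auto
    have "card (?T n) = (\<Sum>i\<le>k. card (?node ` (?T i \<times> ?T (k - i))))"
      unfolding split using fin by (intro card_UN_disjoint) auto
    also have "\<dots> = (\<Sum>i\<le>k. catalan i * catalan (k - i))"
      by (intro sum.cong) (auto simp: card_image inj_on_def card_cartesian_product card)
    finally have "card (?T n) = catalan n"
      using Suc by (simp only: catalan_convolution)
    moreover have "finite (?T n)"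
      unfolding split using fin by auto
    ultimately show ?thesis
      by simp
  qed
qed

section \<open>Sequences obtained by inserting mediants\<close>

text \<open>
  The entries inserted between \<open>p\<close> and \<open>q\<close>: the root of the tree stands for the mediant \<open>p + q\<close>, and
  its subtrees for the insertions made afterwards on either side of it.
\<close>
fun mediants :: "int \<Rightarrow> int \<Rightarrow> unit tree \<Rightarrow> int list" where
  "mediants p q Leaf = []"
| "mediants p q (Node l _ r) = mediants p (p + q) l @ (p + q) # mediants (p + q) q r"

fun divides_neighbours :: "int list \<Rightarrow> bool" where
  "divides_neighbours (a # b # c # xs) \<longleftrightarrow> b dvd a + c \<and> divides_neighbours (b # c # xs)"
| "divides_neighbours _ \<longleftrightarrow> True"

lemma divides_neighbours_iff_nth:
  "divides_neighbours xs \<longleftrightarrow> (\<forall>i. i + 2 < length xs \<longrightarrow> xs ! (i + 1) dvd xs ! i + xs ! (i + 2))"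
proof (induction xs rule: divides_neighbours.induct)
  case (1 a b c xs)
  have "(\<forall>i. P i) \<longleftrightarrow> P 0 \<and> (\<forall>i. P (Suc i))" for P
    by (metis not0_implies_Suc)
  from this[of "\<lambda>i. i + 2 < length (a # b # c # xs) \<longrightarrow>
      (a # b # c # xs) ! (i + 1) dvd (a # b # c # xs) ! i + (a # b # c # xs) ! (i + 2)"]
  show ?case
    using 1 by simp
qed auto

lemma length_mediants [simp]: "length (mediants p q t) = size t"
  by (induction t arbitrary: p q) auto

lemma mediants_ge: "p \<ge> 0 \<Longrightarrow> q \<ge> 0 \<Longrightarrow> x \<in> set (mediants p q t) \<Longrightarrow> x \<ge> p + q"
  by (induction p q t rule: mediants.induct) fastforce+

text \<open>
  The root is visible in the sequence as the first occurrence of \<open>p + q\<close>: every entry to its left is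
  at least \<open>p + (p + q)\<close>. To its right \<open>p + q\<close> may occur again, as \<open>q = 0\<close> is allowed.
\<close>
lemma mediants_inject:
  assumes "p > 0" "q \<ge> 0" "mediants p q t = mediants p q t'"
  shows "t = t'"
  using assms
proof (induction t arbitrary: p q t')
  case Leaf
  then show ?case
    by (cases t') auto
next
  case (Node l u r)
  obtain l' u' r' where t': "t' = Node l' u' r'"
    using Node.prems by (cases t') auto
  let ?s = "p + q"
  have notin: "?s \<notin> set (mediants p ?s s)" for s
    using mediants_ge[of p ?s ?s s] Node.prems by auto
  have "mediants p ?s l @ ?s # mediants ?s q r = mediants p ?s l' @ ?s # mediants ?s q r'"
    using Node.prems t' by simp
  then have "mediants p ?s l = mediants p ?s l' \<and> mediants ?s q r = mediants ?s q r'"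
    using notin[of l] notin[of l'] unfolding append_eq_append_conv2 append_eq_Cons_conv
    by (auto simp: Cons_eq_append_conv) (metis in_set_conv_decomp)+
  then show ?case
    using Node.IH(1)[of p ?s l'] Node.IH(2)[of ?s q r'] Node.prems t' by simp
qed

text \<open>
  The new entry divides \<open>a + c\<close>. For \<open>a\<close>, the neighbour \<open>c\<close> is replaced by \<open>a + c\<close>, which is
  congruent to \<open>c\<close> modulo \<open>a\<close>; likewise for \<open>c\<close>.
\<close>
lemma divides_neighbours_insert_sum:
  "divides_neighbours (us @ a # (a + c) # c # vs) \<longleftrightarrow> divides_neighbours (us @ a # c # vs)"
proof (induction us rule: induct_list012)
  case 1
  have "c dvd (a + c) + v \<longleftrightarrow> c dvd a + v" for v
    using dvd_add_right_iff[of c c "a + v"] by (simp add: algebra_simps)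
  then show ?case
    by (cases vs) auto
next
  case (2 u)
  have "c dvd (a + c) + v \<longleftrightarrow> c dvd a + v" for v
    using dvd_add_right_iff[of c c "a + v"] by (simp add: algebra_simps)
  moreover have "a dvd u + (a + c) \<longleftrightarrow> a dvd u + c"
    using dvd_add_right_iff[of a a "u + c"] by (simp add: algebra_simps)
  ultimately show ?case
    by (cases vs) auto
next
  case (3 u v us)
  then show ?case
    by (cases us) auto
qed

lemma divides_neighbours_mediants:
  "divides_neighbours (us @ p # mediants p q t @ q # vs) \<longleftrightarrow> divides_neighbours (us @ p # q # vs)"
proof (induction t arbitrary: p q us vs)
  case (Node l x r)
  let ?s = "p + q"
  have "divides_neighbours (us @ p # mediants p q (Node l x r) @ q # vs) \<longleftrightarrow>
      divides_neighbours (us @ p # ?s # mediants ?s q r @ q # vs)"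
    using Node.IH(1)[of us p ?s "mediants ?s q r @ q # vs"] by simp
  also have "\<dots> \<longleftrightarrow> divides_neighbours (us @ p # ?s # q # vs)"
    using Node.IH(2)[of "us @ [p]" ?s q vs] by simp
  also have "\<dots> \<longleftrightarrow> divides_neighbours (us @ p # q # vs)"
    by (rule divides_neighbours_insert_sum)
  finally show ?case .
qed simp

text \<open>
  Inserting one more mediant between adjacent entries replaces a leaf of the tree by a node: each
  pair of adjacent entries corresponds to a leaf.
\<close>
lemma mediants_insert_sum:
  assumes "p # mediants p q t @ [q] = us @ a # b # vs"
  shows "\<exists>t'. p # mediants p q t' @ [q] = us @ a # (a + b) # b # vs"
  using assms
proof (induction t arbitrary: p q us vs)
  case Leaf
  then have "us = [] \<and> a = p \<and> b = q \<and> vs = []"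
    by (cases us) (auto simp: Cons_eq_append_conv)
  then have "p # mediants p q (Node Leaf () Leaf) @ [q] = us @ a # (a + b) # b # vs"
    by simp
  then show ?case ..
next
  case (Node l x r)
  let ?s = "p + q"
  let ?L = "p # mediants p ?s l" and ?R = "mediants ?s q r @ [q]"
  have eq: "(?L @ [?s]) @ ?R = (us @ [a]) @ b # vs"
    using Node.prems by simp
  then obtain zs where zs:
      "?L @ [?s] = (us @ [a]) @ zs \<and> zs @ ?R = b # vs \<or>
       (?L @ [?s]) @ zs = us @ [a] \<and> ?R = zs @ b # vs"
    unfolding append_eq_append_conv2 by blast
  then consider
      (left) vs' where "?L @ [?s] = us @ [a] @ b # vs'" "vs = vs' @ ?R"
    | (right) us' where "us @ [a] = ?L @ [?s] @ us'" "?R = us' @ b # vs"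
  proof (cases zs)
    case Nil
    with zs have "us @ [a] = ?L @ [?s] @ []" "?R = [] @ b # vs"
      by auto
    then show thesis
      by (rule that(2))
  next
    case (Cons z zs')
    from zs show thesis
    proof
      assume "?L @ [?s] = (us @ [a]) @ zs \<and> zs @ ?R = b # vs"
      with Cons have "?L @ [?s] = us @ [a] @ b # zs'" "vs = zs' @ ?R"
        by auto
      then show thesis
        by (rule that(1))
    next
      assume "(?L @ [?s]) @ zs = us @ [a] \<and> ?R = zs @ b # vs"
      then have "us @ [a] = ?L @ [?s] @ zs" "?R = zs @ b # vs"
        by simp_all
      then show thesis
        by (rule that(2))
    qed
  qed
  then show ?case
  proof cases
    case left
    then obtain l' where "p # mediants p ?s l' @ [?s] = us @ a # (a + b) # b # vs'"
      using Node.IH(1)[of p ?s us vs'] by auto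
    then have "p # mediants p q (Node l' () r) @ [q] = us @ a # (a + b) # b # vs"
      using left by simp
    then show ?thesis ..
  next
    case right
    obtain us'' where us'': "us = ?L @ us''" "?s # us' = us'' @ [a]"
    proof (cases us' rule: rev_cases)
      case Nil
      then have "us = ?L" "?s = a"
        using right(1) by simp_all
      then show thesis
        using Nil by (intro that[of "[]"]) simp_all
    next
      case (snoc us'' x)
      then have "us @ [a] = (?L @ [?s] @ us'') @ [x]"
        using right(1) by simp
      then have "us = ?L @ ?s # us''" "a = x"
        by simp_all
      then show thesis
        using snoc by (intro that[of "?s # us''"]) simp_all
    qed
    then obtain r' where "?s # mediants ?s q r' @ [q] = us'' @ a # (a + b) # b # vs"
      using Node.IH(2)[of ?s q us'' vs] right(2) by auto
    then have "p # mediants p q (Node l () r') @ [q] = us @ a # (a + b) # b # vs"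
      using us'' by simp
    then show ?thesis ..
  qed
qed

text \<open>
  Induction on the number of entries, removing the last maximal entry \<open>M\<close>. Its neighbours satisfy
  \<open>a \<le> M\<close> and \<open>c < M\<close>, so \<open>0 < a + c < 2 * M\<close>, and divisibility leaves only \<open>a + c = M\<close>. Choosing the
  last one matters: in \<open>1, 1, 1, 0\<close> the first inner \<open>1\<close> is not the sum of its neighbours.
\<close>
lemma ex_mediants:
  assumes "divides_neighbours (1 # ys @ [0])" "\<forall>y \<in> set ys. y > 0"
  shows "\<exists>t. ys = mediants 1 0 t"
  using assms
proof (induction "length ys" arbitrary: ys)
  case 0
  then have "ys = mediants 1 0 Leaf"
    by simp
  then show ?case ..
next
  case (Suc n)
  define M where "M = Max (set ys)"
  have "ys \<noteq> []"
    using Suc.hyps(2) by auto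
  then have "M \<in> set ys" and le: "\<forall>y \<in> set ys. y \<le> M"
    by (auto simp: M_def)
  then obtain us vs where ys: "ys = us @ M # vs" and vs: "M \<notin> set vs"
    by (meson split_list_last)
  obtain us' a where us': "1 # us = us' @ [a]"
    by (metis append_butlast_last_id list.distinct(1))
  obtain c vs' where vs': "vs @ [0] = c # vs'"
    by (cases vs) auto
  have split: "1 # ys @ [0] = us' @ a # M # c # vs'"
    using us' vs' ys by (metis append.assoc append_Cons append_Nil)
  have "M > 0"
    using Suc.prems(2) \<open>M \<in> set ys\<close> by blast
  have "a \<in> insert 1 (set us)"
    using us' by (metis in_set_conv_decomp list.simps(15))
  then have a: "0 < a" "a \<le> M"
    using Suc.prems(2) le ys \<open>M > 0\<close> by auto
  have "c \<in> insert 0 (set vs)"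
    using vs' by (metis Un_insert_right list.set_intros(1) list.simps(15) set_append sup_bot_right
        list.set(1))
  then have c: "0 \<le> c" "c < M"
    using Suc.prems(2) le ys vs \<open>M > 0\<close> by (auto simp: order_less_le)
  have "M dvd a + c"
    using Suc.prems(1) unfolding split divides_neighbours_iff_nth
    by (auto dest!: spec[of _ "length us'"] simp: nth_append)
  then obtain k where k: "a + c = M * k" ..
  have "k = 1"
  proof -
    have "0 < M * k" "M * k < M * 2"
      using a c unfolding k[symmetric] by auto
    then have "0 < k" "k < 2"
      using \<open>M > 0\<close> by (simp_all add: zero_less_mult_iff)
    then show ?thesis
      by simp
  qed
  with k have M: "M = a + c"
    by simp
  define zs where "zs = us @ vs"
  have zs: "1 # zs @ [0] = us' @ a # c # vs'"
    unfolding zs_def using us' vs' by (metis append.assoc append_Cons append_Nil)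
  have "divides_neighbours (1 # zs @ [0])"
    using Suc.prems(1) unfolding split zs M divides_neighbours_insert_sum .
  moreover have "n = length zs" "\<forall>z \<in> set zs. z > 0"
    using Suc.hyps(2) Suc.prems(2) by (auto simp: ys zs_def)
  ultimately obtain t where t: "zs = mediants 1 0 t"
    using Suc.hyps(1) by blast
  have "1 # mediants 1 0 t @ [0] = us' @ a # c # vs'"
    using zs t by simp
  from mediants_insert_sum[OF this] obtain t' where "1 # mediants 1 0 t' @ [0] = 1 # ys @ [0]"
    unfolding split M by blast
  then show ?case
    by auto
qed

section \<open>Arithmetical structures as divisibility conditions\<close>

definition neighbours :: "'a pair_pre_digraph \<Rightarrow> 'a \<Rightarrow> 'a set" where
  "neighbours G u = {v \<in> pverts G. (u, v) \<in> parcs G}"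

lemma mem_arithmetical_structures:
  assumes "finite (pverts G)"
  shows "(d, r) \<in> arithmetical_structures G \<longleftrightarrow>
    d \<in> pverts G \<rightarrow>\<^sub>E {0<..} \<and> r \<in> pverts G \<rightarrow>\<^sub>E {0<..} \<and> Gcd (r ` pverts G) = 1 \<and>
    (\<forall>u \<in> pverts G. d u * r u = sum r (neighbours G u))"
proof -
  have "(\<Sum>v \<in> pverts G. (diag_matrix d u v - adjacency_matrix G u v) * r v)
      = d u * r u - sum r (neighbours G u)" if "u \<in> pverts G" for u
  proof -
    have "(\<Sum>v \<in> pverts G. diag_matrix d u v * r v) = (\<Sum>v \<in> pverts G. if u = v then d u * r v else 0)"
      by (intro sum.cong) (auto simp: diag_matrix_def)
    moreover have "(\<Sum>v \<in> pverts G. adjacency_matrix G u v * r v) = sum r (neighbours G u)"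
      unfolding neighbours_def using assms
      by (subst sum.inter_filter) (auto intro: sum.cong simp: adjacency_matrix_def)
    ultimately show ?thesis
      using assms that by (simp add: left_diff_distrib sum_subtractf)
  qed
  then show ?thesis
    by (simp add: arithmetical_structures_def)
qed

lemma sum_neighbours_cartesian_product:
  fixes r :: "'a \<times> 'b \<Rightarrow> int"
  assumes "pair_graph G" "pair_graph H" "u \<in> pverts G" "v \<in> pverts H"
  shows "sum r (neighbours (G \<box> H) (u, v)) =
    (\<Sum>v' \<in> neighbours H v. r (u, v')) + (\<Sum>u' \<in> neighbours G u. r (u', v))"
proof -
  interpret G: pair_graph G by fact
  interpret H: pair_graph H by fact
  have fin: "finite (neighbours H v)" "finite (neighbours G u)"
    by (auto simp: neighbours_def)
  have "neighbours (G \<box> H) (u, v) = Pair u ` neighbours H v \<union> (\<lambda>u'. (u', v)) ` neighbours G u"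
    using assms by (auto simp: neighbours_def cartesian_product_def)
  moreover have "Pair u ` neighbours H v \<inter> (\<lambda>u'. (u', v)) ` neighbours G u = {}"
    by (auto simp: neighbours_def dest: G.pair_no_loops)
  ultimately show ?thesis
    using fin by (simp add: sum.union_disjoint sum.reindex inj_on_def)
qed

lemma pverts_path_graph [simp]: "pverts (path_graph m) = {1..m}"
  by (simp add: path_graph_def)

text \<open>
  The end vertices need no special treatment if \<open>s\<close> vanishes at the two indices next to the path.
\<close>
lemma sum_neighbours_path_graph:
  fixes s :: "nat \<Rightarrow> int"
  assumes "i \<in> {1..m}" "s 0 = 0" "s (m + 1) = 0"
  shows "sum s (neighbours (path_graph m) i) = s (i - 1) + s (i + 1)"
proof -
  have "sum s (neighbours (path_graph m) i) = sum s {i - 1, i + 1}"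
  proof (rule sum.mono_neutral_left)
    show "neighbours (path_graph m) i \<subseteq> {i - 1, i + 1}"
      by (auto simp: neighbours_def path_graph_def)
    show "\<forall>j \<in> {i - 1, i + 1} - neighbours (path_graph m) i. s j = 0"
    proof
      fix j
      assume "j \<in> {i - 1, i + 1} - neighbours (path_graph m) i"
      then have "j = 0 \<or> j = m + 1"
        using assms(1) by (auto simp: neighbours_def path_graph_def)
      then show "s j = 0"
        using assms by auto
    qed
  qed simp
  then show ?thesis
    by simp
qed

section \<open>Counting the arithmetical structures on a path\<close>

text \<open>
  The borders \<open>0\<close> make the recurrence uniform at the ends of the path and put \<open>r\<^sub>i\<close> at index \<open>i\<close>.
\<close>
definition padded_sequence :: "unit tree \<Rightarrow> int list" where
  "padded_sequence t = 0 # 1 # mediants 1 0 t @ [0]"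

definition tree_structure :: "nat \<Rightarrow> unit tree \<Rightarrow> (nat \<Rightarrow> int) \<times> (nat \<Rightarrow> int)" where
  "tree_structure m t = (let s = (\<lambda>i. padded_sequence t ! i) in
     (\<lambda>i\<in>{1..m}. (s (i - 1) + s (i + 1)) div s i, \<lambda>i\<in>{1..m}. s i))"

lemma path_structure_recurrence:
  assumes "(d, r) \<in> arithmetical_structures (path_graph m)" "i \<in> {1..m}"
    and s: "s = (\<lambda>i. if i \<in> {1..m} then r i else 0)"
  shows "d i * s i = s (i - 1) + s (i + 1)"
proof -
  have "d i * r i = sum r (neighbours (path_graph m) i)"
    using assms by (simp add: mem_arithmetical_structures)
  also have "\<dots> = sum s (neighbours (path_graph m) i)"
    by (intro sum.cong) (auto simp: neighbours_def s)
  also have "\<dots> = s (i - 1) + s (i + 1)"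
    using assms(2) by (intro sum_neighbours_path_graph) (auto simp: s)
  finally show ?thesis
    using assms(2) by (simp add: s)
qed

text \<open>
  Solving the recurrence for \<open>s (i + 1)\<close> expresses all entries as integer combinations of \<open>s 0 = 0\<close>
  and \<open>s 1\<close>; so \<open>r 1\<close> divides them all, and hence their gcd.
\<close>
lemma path_structure_first_eq_1:
  assumes "m \<ge> 1" "(d, r) \<in> arithmetical_structures (path_graph m)"
  shows "r 1 = 1"
proof -
  define s where "s = (\<lambda>i. if i \<in> {1..m} then r i else 0)"
  note dr = path_structure_recurrence[OF assms(2) _ s_def]
  have "s 1 dvd s i \<and> s 1 dvd s (i + 1)" if "i \<le> m" for i
    using that
  proof (induction i)
    case (Suc i)
    have "s (i + 2) = d (i + 1) * s (i + 1) - s i"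
      using dr[of "i + 1"] Suc.prems by simp
    then show ?case
      using Suc by simp
  qed (simp add: s_def)
  then have "r 1 dvd x" if "x \<in> r ` {1..m}" for x
    using that assms(1) by (force simp: s_def)
  then have "r 1 dvd Gcd (r ` {1..m})"
    by (rule Gcd_greatest)
  moreover have "Gcd (r ` {1..m}) = 1" "r 1 > 0"
    using assms by (auto simp: mem_arithmetical_structures)
  ultimately show ?thesis
    by simp
qed

lemma bij_betw_tree_structure:
  assumes "m \<ge> 2"
  shows "bij_betw (tree_structure m) {t. size t = m - 1} (arithmetical_structures (path_graph m))"
  (is "bij_betw _ ?T ?A")
proof (rule bij_betwI')
  fix t t' :: "unit tree"
  assume t: "t \<in> ?T" "t' \<in> ?T"
  show "tree_structure m t = tree_structure m t' \<longleftrightarrow> t = t'"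
  proof
    assume eq: "tree_structure m t = tree_structure m t'"
    have "mediants 1 0 t = mediants 1 0 t'"
    proof (rule nth_equalityI)
      fix i
      assume i: "i < length (mediants 1 0 t)"
      have "i + 2 \<in> {1..m}"
        using i t by simp
      then have "padded_sequence t ! (i + 2) = padded_sequence t' ! (i + 2)"
        using arg_cong[OF eq, of "\<lambda>(d, r). r (i + 2)"]
        by (simp add: tree_structure_def Let_def)
      then show "mediants 1 0 t ! i = mediants 1 0 t' ! i"
        using i t by (simp add: padded_sequence_def nth_append)
    qed (use t in simp)
    then show "t = t'"
      by (intro mediants_inject[of 1 0]) auto
  qed simp
next
  fix t :: "unit tree"
  assume "t \<in> ?T"
  define s where "s i = padded_sequence t ! i" for i
  have len: "length (padded_sequence t) = m + 2"
    using \<open>t \<in> ?T\<close> assms by (simp add: padded_sequence_def)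
  have s: "s 0 = 0" "s 1 = 1" "s (m + 1) = 0"
    using \<open>t \<in> ?T\<close> assms by (auto simp: s_def padded_sequence_def nth_append nth_Cons')
  have pos: "s i > 0" if i: "i \<in> {1..m}" for i
  proof (cases "i = 1")
    case False
    then have "s i = mediants 1 0 t ! (i - 2)"
      using i \<open>t \<in> ?T\<close>
      by (auto simp: s_def padded_sequence_def nth_append nth_Cons' numeral_2_eq_2)
    moreover have "i - 2 < length (mediants 1 0 t)"
      using False i \<open>t \<in> ?T\<close> by auto
    ultimately have "s i \<in> set (mediants 1 0 t)"
      by simp
    then show ?thesis
      using mediants_ge[of 1 0 "s i" t] by simp
  qed (use s in simp)
  have "divides_neighbours (padded_sequence t)"
    using divides_neighbours_mediants[of "[0]" 1 0 t "[]"] by (simp add: padded_sequence_def)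
  then have "s (i + 1) dvd s i + s (i + 2)" if "i < m" for i
    using that by (simp add: divides_neighbours_iff_nth len s_def)
  then have dvd: "s i dvd s (i - 1) + s (i + 1)" if "i \<in> {1..m}" for i
    using that by (cases i) auto
  have nonneg: "s i \<ge> 0" if "i \<le> m + 1" for i
    using pos[of i] s that by (cases "i = 0 \<or> i = m + 1") auto
  have sum_pos: "s (i - 1) + s (i + 1) > 0" if i: "i \<in> {1..m}" for i
  proof (cases "i = 1")
    case True
    then show ?thesis
      using s pos[of 2] assms by (simp add: numeral_2_eq_2)
  next
    case False
    then have "s (i - 1) > 0" "s (i + 1) \<ge> 0"
      using i by (auto intro!: pos nonneg)
    then show ?thesis
      by simp
  qed
  define d where "d = (\<lambda>i\<in>{1..m}. (s (i - 1) + s (i + 1)) div s i)"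
  have d: "d i * s i = s (i - 1) + s (i + 1)" if "i \<in> {1..m}" for i
    using dvd[OF that] that by (simp add: d_def)
  have d_pos: "d i > 0" if "i \<in> {1..m}" for i
    using d[OF that] sum_pos[OF that] pos[OF that] by (metis zero_less_mult_pos2)
  define r where "r = (\<lambda>i\<in>{1..m}. s i)"
  have "Gcd (r ` {1..m}) = 1"
  proof -
    have "1 \<in> r ` {1..m}"
      using s assms by (auto simp: r_def image_iff intro!: bexI[of _ 1])
    then have "Gcd (r ` {1..m}) dvd 1"
      by (rule Gcd_dvd)
    then show ?thesis
      using Gcd_int_greater_eq_0 by (metis abs_of_nonneg zdvd1_eq)
  qed
  moreover have "sum r (neighbours (path_graph m) i) = d i * r i" if "i \<in> {1..m}" for i
  proof -
    have "sum r (neighbours (path_graph m) i) = sum s (neighbours (path_graph m) i)"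
      by (intro sum.cong) (auto simp: neighbours_def r_def)
    then show ?thesis
      using sum_neighbours_path_graph[of i m s] that s d by (simp add: r_def)
  qed
  moreover have "d \<in> {1..m} \<rightarrow>\<^sub>E {0<..}" "r \<in> {1..m} \<rightarrow>\<^sub>E {0<..}"
    using d_pos pos by (auto simp: d_def r_def)
  ultimately have "(d, r) \<in> ?A"
    by (simp add: mem_arithmetical_structures)
  then show "tree_structure m t \<in> ?A"
    by (simp add: tree_structure_def Let_def d_def r_def s_def)
next
  fix x
  assume "x \<in> ?A"
  then obtain d r where x: "x = (d, r)" and dr: "(d, r) \<in> ?A"
    by (cases x) auto
  then have d: "d \<in> {1..m} \<rightarrow>\<^sub>E {0<..}" and r: "r \<in> {1..m} \<rightarrow>\<^sub>E {0<..}"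
    by (auto simp: mem_arithmetical_structures)
  define s where "s = (\<lambda>i. if i \<in> {1..m} then r i else 0)"
  have s: "s 0 = 0" "s 1 = 1" "s (m + 1) = 0"
    using path_structure_first_eq_1[OF _ dr] assms by (auto simp: s_def)
  note recurrence = path_structure_recurrence[OF dr _ s_def]
  define ys where "ys = map s [2..<m + 1]"
  have "[1..<m + 2] = 1 # [2..<m + 1] @ [m + 1]"
    using assms upt_conv_Cons[of 1 "m + 2"] upt_Suc_append[of 2 "m + 1"]
    by (simp add: numeral_2_eq_2 del: upt_Suc)
  then have all: "1 # ys @ [0] = map s [1..<m + 2]"
    using s by (simp add: ys_def del: upt_Suc)
  have "divides_neighbours (1 # ys @ [0])"
    unfolding all divides_neighbours_iff_nth
  proof (intro allI impI)
    fix i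
    assume "i + 2 < length (map s [1..<m + 2])"
    then have i: "i + 2 \<in> {1..m}"
      by (simp del: upt_Suc)
    have nth: "map s [1..<m + 2] ! k = s (k + 1)" if "k \<le> m" for k
      using that by (simp del: upt_Suc)
    have "s (i + 2) dvd s (i + 1) + s (i + 3)"
      using recurrence[OF i] dvd_triv_right[of "s (i + 2)" "d (i + 2)"]
      by (simp add: numeral_3_eq_3)
    then show "map s [1..<m + 2] ! (i + 1) dvd
        map s [1..<m + 2] ! i + map s [1..<m + 2] ! (i + 2)"
      using i by (simp add: nth numeral_3_eq_3 del: upt_Suc)
  qed
  moreover have "\<forall>y \<in> set ys. y > 0"
    using r by (auto simp: ys_def s_def)
  ultimately obtain t where t: "ys = mediants 1 0 t"
    using ex_mediants by blast
  have size: "size t = m - 1"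
    using arg_cong[OF t, of length] by (simp add: ys_def del: upt_Suc)
  have pad: "padded_sequence t = map s [0..<m + 2]"
    unfolding padded_sequence_def t[symmetric] all using s
    by (simp add: upt_conv_Cons[of 0] del: upt_Suc)
  have nth: "padded_sequence t ! i = s i" if "i \<le> m + 1" for i
    unfolding pad using that by (simp del: upt_Suc)
  have "(\<lambda>i\<in>{1..m}. (s (i - 1) + s (i + 1)) div s i) = d"
  proof
    fix i
    show "(\<lambda>i\<in>{1..m}. (s (i - 1) + s (i + 1)) div s i) i = d i"
    proof (cases "i \<in> {1..m}")
      case True
      then have "s i \<noteq> 0"
        using r by (auto simp: s_def PiE_iff dest!: bspec[of _ _ i])
      then show ?thesis
        using True recurrence[OF True] by (metis nonzero_mult_div_cancel_right restrict_apply)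
    qed (use d in \<open>auto simp: PiE_iff extensional_def\<close>)
  qed
  moreover have "(\<lambda>i\<in>{1..m}. s i) = r"
    using r by (auto simp: s_def PiE_iff extensional_def)
  moreover have "tree_structure m t =
      (\<lambda>i\<in>{1..m}. (s (i - 1) + s (i + 1)) div s i, \<lambda>i\<in>{1..m}. s i)"
    unfolding tree_structure_def Let_def by (intro arg_cong2[of _ _ _ _ Pair] restrict_ext)
      (auto simp: nth)
  ultimately show "\<exists>t \<in> ?T. x = tree_structure m t"
    using size x by auto
qed

section \<open>Symmetric structures on the ladder\<close>

definition duplicate_structure ::
    "nat \<Rightarrow> (nat \<Rightarrow> int) \<times> (nat \<Rightarrow> int) \<Rightarrow> (nat \<times> nat \<Rightarrow> int) \<times> (nat \<times> nat \<Rightarrow> int)" where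
  "duplicate_structure m = (\<lambda>(d, r).
     (\<lambda>(j, i)\<in>{1..2} \<times> {1..m}. d i + 1, \<lambda>(j, i)\<in>{1..2} \<times> {1..m}. r i))"

lemma sum_neighbours_ladder:
  fixes r :: "nat \<times> nat \<Rightarrow> int"
  assumes "j \<in> {1..2}" "i \<in> {1..m}" "\<And>i. i \<in> {1..m} \<Longrightarrow> r (1, i) = r (2, i)"
  shows "sum r (neighbours (path_graph 2 \<box> path_graph m) (j, i)) =
    (\<Sum>i' \<in> neighbours (path_graph m) i. r (1, i')) + r (1, i)"
proof -
  have j: "j = 1 \<or> j = 2"
    using assms(1) by auto
  then have "neighbours (path_graph 2) j = {3 - j}"
    by (auto simp: neighbours_def path_graph_def)
  moreover have "r (3 - j, i) = r (1, i)"
    using j assms by auto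
  moreover have "(\<Sum>i' \<in> neighbours (path_graph m) i. r (j, i')) =
      (\<Sum>i' \<in> neighbours (path_graph m) i. r (1, i'))"
    using j assms(3) by (intro sum.cong) (auto simp: neighbours_def)
  ultimately show ?thesis
    using assms by (simp add: sum_neighbours_cartesian_product pair_graph_path_graph)
qed

text \<open>
  By symmetry the first row alone carries \<open>r\<close>. The equations at \<open>(1, i)\<close> and \<open>(2, i)\<close> both
  involve only this row, which forces \<open>d\<close> to be symmetric as well.
\<close>
lemma mem_symmetric_structures:
  "(d, r) \<in> symmetric_structures m \<longleftrightarrow>
    d \<in> {1..2} \<times> {1..m} \<rightarrow>\<^sub>E {0<..} \<and> r \<in> {1..2} \<times> {1..m} \<rightarrow>\<^sub>E {0<..} \<and>
    (\<forall>i \<in> {1..m}. r (1, i) = r (2, i)) \<and> Gcd ((\<lambda>i. r (1, i)) ` {1..m}) = 1 \<and>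
    (\<forall>j \<in> {1..2}. \<forall>i \<in> {1..m}. d (j, i) * r (1, i) =
       (\<Sum>i' \<in> neighbours (path_graph m) i. r (1, i')) + r (1, i))"
proof -
  let ?G = "path_graph 2 \<box> path_graph m"
  have verts: "pverts ?G = {1..2} \<times> {1..m}"
    by (simp add: cartesian_product_def)
  show ?thesis
  proof (cases "\<forall>i \<in> {1..m}. r (1, i) = r (2, i)")
    case True
    have rj: "r (j, i) = r (1, i)" if "j \<in> {1..2}" "i \<in> {1..m}" for j i
    proof -
      have "j = 1 \<or> j = 2"
        using that by auto
      then show ?thesis
        using True that by auto
    qed
    have "r ` ({1..2} \<times> {1..m}) = (\<lambda>i. r (1, i)) ` {1..m}"
    proof
      show "r ` ({1..2} \<times> {1..m}) \<subseteq> (\<lambda>i. r (1, i)) ` {1..m}"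
        using rj by blast
      show "(\<lambda>i. r (1, i)) ` {1..m} \<subseteq> r ` ({1..2} \<times> {1..m})"
        by (rule image_subsetI, rule imageI) auto
    qed
    moreover have "d (j, i) * r (j, i) = sum r (neighbours ?G (j, i)) \<longleftrightarrow>
        d (j, i) * r (1, i) = (\<Sum>i' \<in> neighbours (path_graph m) i. r (1, i')) + r (1, i)"
      if "j \<in> {1..2}" "i \<in> {1..m}" for j i
    proof -
      have "sum r (neighbours ?G (j, i)) =
          (\<Sum>i' \<in> neighbours (path_graph m) i. r (1, i')) + r (1, i)"
        using that True by (intro sum_neighbours_ladder) blast+
      then show ?thesis
        by (simp only: rj[OF that])
    qed
    then have "(\<forall>u \<in> {1..2} \<times> {1..m}. d u * r u = sum r (neighbours ?G u)) \<longleftrightarrow>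
        (\<forall>j \<in> {1..2}. \<forall>i \<in> {1..m}. d (j, i) * r (1, i) =
           (\<Sum>i' \<in> neighbours (path_graph m) i. r (1, i')) + r (1, i))"
      by (simp only: split_paired_Ball_Sigma cong: ball_cong)
    moreover have "(d, r) \<in> symmetric_structures m \<longleftrightarrow> (d, r) \<in> arithmetical_structures ?G"
      using True by (simp add: symmetric_structures_def)
    moreover have "finite (pverts ?G)"
      by (simp add: verts)
    ultimately show ?thesis
      using True by (simp only: mem_arithmetical_structures verts) blast
  qed (auto simp: symmetric_structures_def)
qed

lemma bij_betw_duplicate_structure:
  assumes "m \<ge> 2"
  shows "bij_betw (duplicate_structure m) (arithmetical_structures (path_graph m))
    (symmetric_structures m)"
  (is "bij_betw _ ?A ?S")
proof (rule bij_betwI')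
  fix x y
  assume xy: "x \<in> ?A" "y \<in> ?A"
  obtain d r d' r' where x: "x = (d, r)" and y: "y = (d', r')"
    by (cases x, cases y) auto
  show "duplicate_structure m x = duplicate_structure m y \<longleftrightarrow> x = y"
  proof
    assume eq: "duplicate_structure m x = duplicate_structure m y"
    have "d i = d' i \<and> r i = r' i" if "i \<in> {1..m}" for i
      using arg_cong[OF eq, of "\<lambda>(d, r). (d (1, i), r (1, i))"] that
      by (simp add: x y duplicate_structure_def)
    moreover have "{d, d', r, r'} \<subseteq> extensional {1..m}"
      using xy by (auto simp: x y mem_arithmetical_structures PiE_iff)
    ultimately have "d = d'" "r = r'"
      by (auto intro: extensionalityI)
    then show "x = y"
      by (simp add: x y)
  qed simp
next
  fix x
  assume "x \<in> ?A"
  moreover obtain d r where x: "x = (d, r)"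
    by (cases x)
  ultimately have dr: "d \<in> {1..m} \<rightarrow>\<^sub>E {0<..}" "r \<in> {1..m} \<rightarrow>\<^sub>E {0<..}" "Gcd (r ` {1..m}) = 1"
    "\<And>i. i \<in> {1..m} \<Longrightarrow> d i * r i = sum r (neighbours (path_graph m) i)"
    by (auto simp: mem_arithmetical_structures)
  have pos: "d i > 0" "r i > 0" if "i \<in> {1..m}" for i
    using dr(1,2) that by (auto simp: PiE_iff)
  define D where "D = (\<lambda>(j :: nat, i)\<in>{1..2} \<times> {1..m}. d i + 1)"
  define R where "R = (\<lambda>(j :: nat, i)\<in>{1..2} \<times> {1..m}. r i)"
  have "(\<Sum>i' \<in> neighbours (path_graph m) i. R (1, i')) = sum r (neighbours (path_graph m) i)" for i
    by (intro sum.cong) (auto simp: neighbours_def R_def)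
  moreover have "(\<lambda>i. R (1, i)) ` {1..m} = r ` {1..m}"
    by (intro image_cong) (auto simp: R_def)
  moreover have "D \<in> {1..2} \<times> {1..m} \<rightarrow>\<^sub>E {0<..}" "R \<in> {1..2} \<times> {1..m} \<rightarrow>\<^sub>E {0<..}"
    using pos by (auto simp: D_def R_def less_imp_le)
  moreover have "D (j, i) = d i + 1" "R (j, i) = r i" if "j \<in> {1..2}" "i \<in> {1..m}" for j i
    using that by (simp_all add: D_def R_def)
  ultimately have "(D, R) \<in> ?S"
    using dr(3,4) by (simp add: mem_symmetric_structures distrib_right)
  then show "duplicate_structure m x \<in> ?S"
    by (simp add: x duplicate_structure_def D_def R_def)
next
  fix x
  assume "x \<in> ?S"
  moreover obtain D R where x: "x = (D, R)"
    by (cases x)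
  ultimately have DR: "D \<in> {1..2} \<times> {1..m} \<rightarrow>\<^sub>E {0<..}" "R \<in> {1..2} \<times> {1..m} \<rightarrow>\<^sub>E {0<..}"
    "\<And>i. i \<in> {1..m} \<Longrightarrow> R (1, i) = R (2, i)" "Gcd ((\<lambda>i. R (1, i)) ` {1..m}) = 1"
    and eq: "\<And>j i. j \<in> {1..2} \<Longrightarrow> i \<in> {1..m} \<Longrightarrow> D (j, i) * R (1, i) =
       (\<Sum>i' \<in> neighbours (path_graph m) i. R (1, i')) + R (1, i)"
    by (auto simp: mem_symmetric_structures)
  define d where "d = (\<lambda>i\<in>{1..m}. D (1, i) - 1)"
  define r where "r = (\<lambda>i\<in>{1..m}. R (1, i))"
  have R_pos: "R (1, i) > 0" if "i \<in> {1..m}" for i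
    using DR(2) that by (auto simp: PiE_iff)
  have sum_r: "(\<Sum>i' \<in> neighbours (path_graph m) i. R (1, i')) = sum r (neighbours (path_graph m) i)"
    for i
    by (intro sum.cong) (auto simp: neighbours_def r_def)
  have Dd: "D (j, i) = d i + 1" and dr: "d i * r i = sum r (neighbours (path_graph m) i)"
    if "j \<in> {1..2}" "i \<in> {1..m}" for j i
  proof -
    have "D (j, i) * R (1, i) = D (1, i) * R (1, i)"
      using eq[OF that] eq[of 1 i] that by simp
    then show "D (j, i) = d i + 1"
      using R_pos[OF that(2)] that by (simp add: d_def)
    show "d i * r i = sum r (neighbours (path_graph m) i)"
    proof -
      have "d i = D (1, i) - 1" "r i = R (1, i)"
        using that by (simp_all add: d_def r_def)
      moreover have "D (1, i) * R (1, i) = sum r (neighbours (path_graph m) i) + R (1, i)"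
        using eq[of 1 i] that unfolding sum_r by simp
      ultimately show ?thesis
        by (simp add: left_diff_distrib)
    qed
  qed
  have d_pos: "d i > 0" if i: "i \<in> {1..m}" for i
  proof -
    \<comment> \<open>Some neighbour of \<open>i\<close>; at the left end it is \<open>2\<close>, which is a vertex because \<open>m \<ge> 2\<close>.\<close>
    define k where "k = (if i = 1 then 2 else i - 1)"
    have "k \<in> neighbours (path_graph m) i"
      using i assms by (auto simp: k_def neighbours_def path_graph_def)
    then have "sum r (neighbours (path_graph m) i) > 0"
      using R_pos by (intro sum_pos) (auto simp: neighbours_def r_def)
    then show ?thesis
      using dr[of 1 i] i R_pos[OF i] by (simp add: r_def) (metis zero_less_mult_pos2)
  qed
  have "r ` {1..m} = (\<lambda>i. R (1, i)) ` {1..m}"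
    by (auto simp: r_def)
  moreover have "d \<in> {1..m} \<rightarrow>\<^sub>E {0<..}" "r \<in> {1..m} \<rightarrow>\<^sub>E {0<..}"
    using d_pos R_pos by (auto simp: d_def r_def)
  ultimately have "(d, r) \<in> ?A"
    using DR(4) dr[of 1] by (auto simp: mem_arithmetical_structures)
  moreover have "x = duplicate_structure m (d, r)"
  proof -
    have "D (j, i) = d i + 1 \<and> R (j, i) = r i" if "j \<in> {1..2}" "i \<in> {1..m}" for j i
    proof -
      have "j = 1 \<or> j = 2"
        using that by auto
      then show ?thesis
        using Dd[OF that] DR(3) that by (auto simp: r_def)
    qed
    moreover have "D \<in> extensional ({1..2} \<times> {1..m})" "R \<in> extensional ({1..2} \<times> {1..m})"
      using DR(1,2) by (auto simp: PiE_iff)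
    ultimately show ?thesis
      unfolding x duplicate_structure_def prod.case
      by (auto intro!: extensionalityI[of _ "{1..2} \<times> {1..m}"])
  qed
  ultimately show "\<exists>y \<in> ?A. x = duplicate_structure m y"
    by blast
qed

theorem corollary4p3:
  fixes m :: nat
  assumes "m \<ge> 2"
  shows "(\<exists>f. bij_betw f (symmetric_structures m) (arithmetical_structures (path_graph m))) \<and>
         card (symmetric_structures m) = catalan (m - 1)"
proof
  have sym: "bij_betw (duplicate_structure m) (arithmetical_structures (path_graph m))
      (symmetric_structures m)"
    using assms by (rule bij_betw_duplicate_structure)
  then show "\<exists>f. bij_betw f (symmetric_structures m) (arithmetical_structures (path_graph m))"
    using bij_betw_inv_into by blast
  have "card (symmetric_structures m) = card {t :: unit tree. size t = m - 1}"
    using bij_betw_same_card[OF sym] bij_betw_same_card[OF bij_betw_tree_structure[OF assms]]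
    by simp
  then show "card (symmetric_structures m) = catalan (m - 1)"
    by (simp add: finite_card_trees)
qed

end
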